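(* Let $$P=-\begin{pmatrix}0&1&0&0\\1&2&1&1\\0&1&0&0\\0&1&0&0\end{pmatrix},\qquad \mathbf{P}=\begin{pmatrix}0&P&0&0\\P&0&0&0\\0&0&0&P\\0&0&P&0\end{pmatrix}\in\mathbb{R}^{16\times16}$$ (a $4\times 4$ block matrix with $4\times4$ blocks). Then $\mathbf{P}$ belongs to the closure of the set $$\{\mathbf{X}\in\mathbb{R}^{16\times16}:\ G\otimes E+E\otimes H+\mathbf{X}\succeq 0\ \text{for some } G,H\in\mathbb{R}^{4\times4}\}.$$
   Context: $E\in\mathbb{R}^{4\times4}$ is the all-ones matrix; $\otimes$ is the Kronecker product (so $G\otimes E$ has $(i,j)$ block $G_{ij}E$); $N\succeq0$ means $N$ is symmetric positive semidefinite. *)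

theory Defs
  imports "HOL-Analysis.Analysis"
begin

text \<open>
  Block matrices with blocks indexed by \<open>'m\<close> and positions inside a block indexed by \<open>'n\<close>
  are matrices over the index type \<open>'m \<times> 'n\<close>: the entry at row \<open>(i, k)\<close> and column \<open>(j, l)\<close>
  is the \<open>(k, l)\<close> entry of the \<open>(i, j)\<close> block. In particular a real 16 by 16 matrix, viewed as
  a 4 by 4 block matrix with 4 by 4 blocks, has type \<open>real ^ (4 \<times> 4) ^ (4 \<times> 4)\<close>.
\<close>

definition block_matrix :: "'a ^ 'n ^ 'n ^ 'm ^ 'm \<Rightarrow> 'a ^ ('m \<times> 'n) ^ ('m \<times> 'n)" where
  "block_matrix B = (\<chi> r c. B $ fst r $ fst c $ snd r $ snd c)"

definition kronecker ::
    "real ^ 'm ^ 'm \<Rightarrow> real ^ 'n ^ 'n \<Rightarrow> real ^ ('m \<times> 'n) ^ ('m \<times> 'n)"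
    (infixl \<open>\<otimes>\<^sub>K\<close> 75) where
  "A \<otimes>\<^sub>K B = block_matrix (\<chi> i j. A $ i $ j *\<^sub>R B)"

definition pos_semidef :: "real ^ 'n ^ 'n \<Rightarrow> bool" where
  "pos_semidef N \<longleftrightarrow> transpose N = N \<and> (\<forall>x. 0 \<le> x \<bullet> (N *v x))"

definition E :: "real ^ 4 ^ 4" where
  "E = (\<chi> i j. 1)"

text \<open>
  The entries of a \<open>vector\<close> list occupy the indices 1, 2, 3, 4 in this order; the index 4 is
  the element 0 of the numeral type.
\<close>

definition P :: "real ^ 4 ^ 4" where
  "P = - vector
     [vector [0, 1, 0, 0],
      vector [1, 2, 1, 1],
      vector [0, 1, 0, 0],
      vector [0, 1, 0, 0]]"

definition bigP :: "real ^ (4 \<times> 4) ^ (4 \<times> 4)" where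
  "bigP = block_matrix (vector
     [vector [0, P, 0, 0],
      vector [P, 0, 0, 0],
      vector [0, 0, 0, P],
      vector [0, 0, P, 0]])"

end

theory Submission
  imports Defs
begin

text \<open>
  Read a vector \<open>x\<close> of length 16 as a 4 by 4 array \<open>x\<^sub>i\<^sub>k\<close>, where \<open>i\<close> is the block and \<open>k\<close> the
  position in it, and let \<open>r\<^sub>i = \<Sum>\<^sub>k x\<^sub>i\<^sub>k\<close> be its row sums. The quadratic form of
  \<open>G \<otimes> E\<close> is that of \<open>G\<close> at \<open>r\<close>. Since \<open>P = -(e\<^sub>2 1\<^sup>T + 1 e\<^sub>2\<^sup>T)\<close>, where \<open>1\<close> is the all-ones
  vector, the quadratic form of the given block matrix is
  \<open>-2 \<Sum>\<^sub>i x\<^sub>i\<^sub>2 r\<^bsub>\<sigma> i\<^esub>\<close>, where \<open>\<sigma>\<close> exchanges the blocks 1 and 2, and the blocks 3 and 4.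
  Every term has a row sum as a factor, so for \<open>\<epsilon> > 0\<close> the square can be completed by a small
  multiple of \<open>\<Sum>\<^sub>i x\<^sub>i\<^sub>2\<^sup>2\<close> and a large multiple of \<open>\<Sum>\<^sub>i r\<^sub>i\<^sup>2\<close>:
  \<open>\<epsilon> \<Sum>\<^sub>i x\<^sub>i\<^sub>2\<^sup>2 - 2 \<Sum>\<^sub>i x\<^sub>i\<^sub>2 r\<^bsub>\<sigma> i\<^esub> + \<epsilon>\<inverse> \<Sum>\<^sub>i r\<^sub>i\<^sup>2 = \<epsilon>\<inverse> \<Sum>\<^sub>i (\<epsilon> x\<^sub>i\<^sub>2 - r\<^bsub>\<sigma> i\<^esub>)\<^sup>2 \<ge> 0\<close>.
  The last sum on the left comes from \<open>G = \<epsilon>\<inverse> I\<close>, with \<open>H = 0\<close>. The first one is a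
  perturbation of the given matrix which vanishes as \<open>\<epsilon> \<rightarrow> 0\<close>, however large \<open>G\<close> becomes.

  The lemma \<open>completed_square\<close> is this identity, with the sum of squares
  on the right written as a Gram matrix.
\<close>

lemma pos_semidef_scaled_gram:
  fixes A :: "real ^ 'n ^ 'm"
  assumes "0 \<le> c"
  shows "pos_semidef (c *\<^sub>R (transpose A ** A))"
proof -
  have "x \<bullet> ((c *\<^sub>R (transpose A ** A)) *v x) = c * ((A *v x) \<bullet> (A *v x))" for x
  proof -
    have "x \<bullet> ((c *\<^sub>R (transpose A ** A)) *v x) = c * (x \<bullet> (transpose A *v (A *v x)))"
      by (simp only: scaleR_matrix_vector_assoc[symmetric] matrix_vector_mul_assoc[symmetric]
          inner_scaleR_right)
    also have "x \<bullet> (transpose A *v (A *v x)) = (A *v x) \<bullet> (A *v x)"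
      by (simp only: dot_lmul_matrix[symmetric] vector_transpose_matrix)
    finally show ?thesis .
  qed
  moreover have "transpose (c *\<^sub>R (transpose A ** A)) = c *\<^sub>R (transpose A ** A)"
    by (simp add: transpose_scalar matrix_transpose_mul)
  ultimately show ?thesis
    using assms by (simp add: pos_semidef_def)
qed

definition partner :: "4 \<Rightarrow> 4" where
  "partner i = (if i = 1 then 2 else if i = 2 then 1 else if i = 3 then 4 else 3)"

lemma partner_partner [simp]: "partner (partner i) = i"
  using exhaust_4[of i] by (auto simp: partner_def)

lemma P_entry: "P $ k $ l = - (of_bool (k = 2) + of_bool (l = 2))"
  using exhaust_4[of k] exhaust_4[of l] by (auto simp: P_def vector_def)

lemma bigP_entry:
  "bigP $ (i, k) $ (j, l) = - (of_bool (j = partner i) * (of_bool (k = 2) + of_bool (l = 2)))"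
  using exhaust_4[of i] exhaust_4[of j]
  by (auto simp: bigP_def block_matrix_def partner_def vector_def P_entry)

definition perturbation :: "real ^ (4 \<times> 4) ^ (4 \<times> 4)" where
  "perturbation = (\<chi> r c. of_bool (r = c \<and> snd r = 2))"

text \<open>The matrix of the linear map that sends the array \<open>x\<close> to the vector with entries
  \<open>\<epsilon> x\<^sub>i\<^sub>2 - r\<^bsub>\<sigma> i\<^esub>\<close>.\<close>

definition square_terms :: "real \<Rightarrow> real ^ (4 \<times> 4) ^ 4" where
  "square_terms \<epsilon> = (\<chi> i c. \<epsilon> * of_bool (c = (i, 2)) - of_bool (fst c = partner i))"

lemma gram_square_terms_entry:
  "(transpose (square_terms \<epsilon>) ** square_terms \<epsilon>) $ (i, k) $ (j, l) =
     \<epsilon>\<^sup>2 * of_bool (i = j \<and> k = 2 \<and> l = 2)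
     - \<epsilon> * of_bool (j = partner i) * (of_bool (k = 2) + of_bool (l = 2))
     + of_bool (i = j)"
proof -
  let ?s = "\<Sum>m\<in>UNIV. (\<epsilon> * of_bool (i = m \<and> k = 2) - of_bool (m = partner i)) *
    (\<epsilon> * of_bool (j = m \<and> l = 2) - of_bool (m = partner j))"
  \<comment> \<open>Orienting both conditions towards the summation index turns the sum into \<open>?s\<close>.\<close>
  have swap: "i = partner m \<longleftrightarrow> m = partner i" for i m
    by auto
  have "(transpose (square_terms \<epsilon>) ** square_terms \<epsilon>) $ (i, k) $ (j, l) = ?s"
    by (simp add: matrix_matrix_mult_def transpose_def square_terms_def swap)
  also have "?s = \<epsilon>\<^sup>2 * of_bool (i = j \<and> k = 2 \<and> l = 2)
     - \<epsilon> * of_bool (j = partner i) * (of_bool (k = 2) + of_bool (l = 2))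
     + of_bool (i = j)"
    using exhaust_4[of i] exhaust_4[of j]
    by (elim disjE) (simp_all add: sum_4 partner_def power2_eq_square)
  finally show ?thesis .
qed

text \<open>On the right, the squares of the \<open>x\<^sub>i\<^sub>2\<close> give the perturbation and the squares of the
  row sums give \<open>\<epsilon>\<inverse> I \<otimes> E\<close>, because \<open>\<sigma>\<close> only permutes these squares. The mixed products give
  the given matrix without a power of \<open>\<epsilon>\<close>; this is why the coefficients \<open>\<epsilon>\<close> and \<open>\<epsilon>\<inverse>\<close> are
  balanced in this way.\<close>

lemma completed_square:
  assumes "\<epsilon> \<noteq> 0"
  shows "((1 / \<epsilon>) *\<^sub>R mat 1) \<otimes>\<^sub>K E + E \<otimes>\<^sub>K 0 + (bigP + \<epsilon> *\<^sub>R perturbation) =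
    (1 / \<epsilon>) *\<^sub>R (transpose (square_terms \<epsilon>) ** square_terms \<epsilon>)"
proof -
  have "(((1 / \<epsilon>) *\<^sub>R mat 1) \<otimes>\<^sub>K E + E \<otimes>\<^sub>K 0 + (bigP + \<epsilon> *\<^sub>R perturbation)) $ (i, k) $ (j, l) =
    ((1 / \<epsilon>) *\<^sub>R (transpose (square_terms \<epsilon>) ** square_terms \<epsilon>)) $ (i, k) $ (j, l)" for i k j l
    using assms
    by (auto simp: gram_square_terms_entry bigP_entry perturbation_def kronecker_def
        block_matrix_def E_def mat_def field_simps power2_eq_square)
  then show ?thesis
    by (simp add: vec_eq_iff split_paired_all)
qed

theorem proposition6p1:
  shows "bigP \<in> closure {X :: real ^ (4 \<times> 4) ^ (4 \<times> 4).
    \<exists>G H :: real ^ 4 ^ 4. pos_semidef (G \<otimes>\<^sub>K E + E \<otimes>\<^sub>K H + X)}"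
  (is "_ \<in> closure ?S")
proof -
  have mem: "bigP + \<epsilon> *\<^sub>R perturbation \<in> ?S" if "0 < \<epsilon>" for \<epsilon>
  proof -
    have "pos_semidef (((1 / \<epsilon>) *\<^sub>R mat 1) \<otimes>\<^sub>K E + E \<otimes>\<^sub>K 0 + (bigP + \<epsilon> *\<^sub>R perturbation))"
      using that by (simp only: completed_square) (simp add: pos_semidef_scaled_gram)
    then show ?thesis
      by blast
  qed
  have "((\<lambda>\<epsilon>. bigP + \<epsilon> *\<^sub>R perturbation) \<longlongrightarrow> bigP + 0 *\<^sub>R perturbation) (at_right 0)"
    by (intro tendsto_intros)
  then have "((\<lambda>\<epsilon>. bigP + \<epsilon> *\<^sub>R perturbation) \<longlongrightarrow> bigP) (at_right 0)"
    by simp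
  moreover have "\<forall>\<^sub>F \<epsilon> in at_right 0. bigP + \<epsilon> *\<^sub>R perturbation \<in> closure ?S"
    by (rule eventually_at_right_less[THEN eventually_mono]) (rule subsetD[OF closure_subset mem])
  ultimately show ?thesis
    by (intro Lim_in_closed_set[OF closed_closure]) auto
qed

end
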